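(* Suppose that the random measure $G$ satisfies the Ghirlanda-Guerra identities and let $B\subseteq\mathbb{R}$ be a measurable set with $\mu(B)>0$. Then, with probability one over the choice of $G$, there exists an infinite sequence $(\sigma^l)_{l\geq 1}$ of points in the support of $G$ such that $\sigma^l\cdot\sigma^{l'}\in B$ for all $l\neq l'$.
   Context: $G$ is a random probability measure on the unit ball of a separable Hilbert space $H$. In the definitions below, $(\sigma^l)_{l\geq 1}$ is an i.i.d. sequence from $G$; $\langle\cdot\rangle$ is the average with respect to $G^{\otimes\infty}$; $\mathbb{E}$ is the expectation with respect to the randomness of $G$; $R_{l,l'}=\sigma^l\cdot\sigma^{l'}$ is the scalar product (overlap); and $\mu$ is the law of $R_{1,2}$ under $\mathbb{E}G^{\otimes 2}$. Ghirlanda-Guerra identities: for any $n\geq 2$, any bounded measurable function $f$ of the overlaps $(R_{l,l'})_{l,l'\leq n}$ and any bounded measurable function $\psi$ of one overlap, $$\mathbb{E}\langle f\psi(R_{1,n+1})\rangle=\frac1n\,\mathbb{E}\langle f\rangle\,\mathbb{E}\langle\psi(R_{1,2})\rangle+\frac1n\sum_{l=2}^n\mathbb{E}\langle f\psi(R_{1,l})\rangle .$$ *)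

theory Defs
  imports "HOL-Probability.Probability"
begin

definition random_measure_on_ball ::
  "'w measure \<Rightarrow> ('w \<Rightarrow> 'a::{real_inner, banach, second_countable_topology} measure) \<Rightarrow> bool" where
  "random_measure_on_ball M G \<longleftrightarrow>
     prob_space M \<and>
     G \<in> measurable M (prob_algebra borel) \<and>
     (\<forall>\<omega>\<in>space M. emeasure (G \<omega>) (cball 0 1) = 1)"

definition replica_measure :: "'a measure \<Rightarrow> (nat \<Rightarrow> 'a) measure" where
  "replica_measure N = (\<Pi>\<^sub>M l\<in>{1..}. N)"

definition replica_expectation ::
  "'w measure \<Rightarrow> ('w \<Rightarrow> 'a measure) \<Rightarrow> ((nat \<Rightarrow> 'a) \<Rightarrow> real) \<Rightarrow> real" where
  "replica_expectation M G F = (\<integral>\<omega>. (\<integral>\<sigma>. F \<sigma> \<partial>replica_measure (G \<omega>)) \<partial>M)"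

definition overlap :: "(nat \<Rightarrow> 'a::real_inner) \<Rightarrow> nat \<Rightarrow> nat \<Rightarrow> real" where
  "overlap \<sigma> l l' = \<sigma> l \<bullet> \<sigma> l'"

text \<open>The array is indexed by all pairs, so that it includes the self-overlaps on the diagonal.\<close>

definition overlap_array :: "nat \<Rightarrow> (nat \<Rightarrow> 'a::real_inner) \<Rightarrow> (nat \<times> nat \<Rightarrow> real)" where
  "overlap_array n \<sigma> = (\<lambda>(l, l')\<in>{1..n} \<times> {1..n}. overlap \<sigma> l l')"

definition overlap_law ::
  "'w measure \<Rightarrow> ('w \<Rightarrow> 'a::{real_inner, banach, second_countable_topology} measure) \<Rightarrow> real measure" where
  "overlap_law M G =
     distr (M \<bind> (\<lambda>\<omega>. G \<omega> \<Otimes>\<^sub>M G \<omega>)) borel (\<lambda>(x, y). x \<bullet> y)"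

definition ghirlanda_guerra ::
  "'w measure \<Rightarrow> ('w \<Rightarrow> 'a::{real_inner, banach, second_countable_topology} measure) \<Rightarrow> bool" where
  "ghirlanda_guerra M G \<longleftrightarrow>
     (\<forall>n\<ge>2. \<forall>f :: (nat \<times> nat \<Rightarrow> real) \<Rightarrow> real. \<forall>\<psi> :: real \<Rightarrow> real.
        f \<in> borel_measurable (\<Pi>\<^sub>M p\<in>{1..n} \<times> {1..n}. borel) \<longrightarrow>
        bounded (f ` space (\<Pi>\<^sub>M p\<in>{1..n} \<times> {1..n}. (borel :: real measure))) \<longrightarrow>
        \<psi> \<in> borel_measurable borel \<longrightarrow>
        bounded (range \<psi>) \<longrightarrow>
        replica_expectation M G (\<lambda>\<sigma>. f (overlap_array n \<sigma>) * \<psi> (overlap \<sigma> 1 (n + 1))) =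
          1 / real n * replica_expectation M G (\<lambda>\<sigma>. f (overlap_array n \<sigma>))
                     * replica_expectation M G (\<lambda>\<sigma>. \<psi> (overlap \<sigma> 1 2))
          + 1 / real n * (\<Sum>l=2..n.
              replica_expectation M G (\<lambda>\<sigma>. f (overlap_array n \<sigma>) * \<psi> (overlap \<sigma> 1 l))))"

definition measure_support :: "'a::topological_space measure \<Rightarrow> 'a set" where
  "measure_support N = {x. \<forall>U. open U \<longrightarrow> x \<in> U \<longrightarrow> emeasure N U > 0}"

end

theory Submission imports Defs "HOL-Combinatorics.Transposition" begin

text \<open>
  Call a finite set of replica indices a clique if all overlaps between distinct members lie in
  \<open>B\<close>. The infinite sequence is found inside the sample \<open>(\<sigma>\<^sub>l)\<close> itself: almost surely, every
  nonempty finite clique of replicas is extended by a further replica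
  (\<open>AE_clique_extends\<close>), so cliques can be enlarged forever
  (\<open>infinite_clique_of_extension\<close>), and almost surely all replicas lie in the support
  (\<open>AE_in_measure_support\<close>).

  For the extension property, exchangeability reduces an arbitrary clique to \<open>{1..n}\<close>.
  Let \<open>a m\<close> be the probability that \<open>{1..n}\<close> is a clique which none of the replicas
  \<open>n+1, ..., n+m\<close> extends, let \<open>b m\<close> be the probability that moreover \<open>R\<^sub>1\<^sub>,\<^sub>n\<^sub>+\<^sub>m\<^sub>+\<^sub>1 \<notin> B\<close>, and let
  \<open>q < 1\<close> be the probability that \<open>R\<^sub>1\<^sub>,\<^sub>2 \<notin> B\<close>. Apply the Ghirlanda-Guerra identity with
  \<open>n + m\<close> replicas to the indicator of the event of \<open>a m\<close> and to the indicator of the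
  complement of \<open>B\<close>. The terms \<open>R\<^sub>1\<^sub>,\<^sub>l\<close> with \<open>2 \<le> l \<le> n\<close> vanish because \<open>{1..n}\<close> is a clique. The
  \<open>m\<close> terms with \<open>l > n\<close> are all equal to \<open>b (m - 1)\<close>, because a replica \<open>l\<close> with \<open>R\<^sub>1\<^sub>,\<^sub>l \<notin> B\<close>
  automatically fails to extend the clique. Hence
  \<open>(n + m) b m = q a m + m b (m - 1)\<close>.
  A union bound over the member that prevents the extension gives \<open>a (m + 1) \<le> n b m\<close>.
  If \<open>a\<close> had a positive limit \<open>L\<close>, then
  \<open>m (b (m - 1) - b m) = n b m - q a m \<ge> a (m + 1) - q a m\<close> would eventually stay above a positive constant,
  and the telescoping sum of the differences of \<open>b\<close> would dominate a harmonic series, although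
  \<open>b\<close> is bounded. So \<open>a\<close> tends to \<open>0\<close> (\<open>decreasing_recursion_limit_zero\<close>).
\<close>

section \<open>A recursion that forces convergence to zero\<close>

lemma decreasing_recursion_limit_zero:
  fixes a b :: "nat \<Rightarrow> real" and n :: nat and q :: real
  assumes n: "n \<ge> 1" and q: "q < 1"
    and a0: "\<And>m. 0 \<le> a m" and b0: "\<And>m. 0 \<le> b m" and dec: "decseq a"
    and rec: "\<And>m. real (n + Suc m) * b (Suc m) = q * a (Suc m) + real (Suc m) * b m"
    and le: "\<And>m. a (Suc m) \<le> real n * b m"
  shows "a \<longlonglongrightarrow> 0"
proof -
  obtain L where L: "a \<longlonglongrightarrow> L" and Lle: "\<And>m. L \<le> a m"
    using decseq_convergent[OF dec, of 0] a0 by blast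
  have "L \<ge> 0" using LIMSEQ_le_const[OF L] a0 by blast
  have "L = 0"
  proof (rule ccontr)
    assume "L \<noteq> 0"
    with \<open>L \<ge> 0\<close> have Lpos: "L > 0" by simp
    \<comment> \<open>Half the limit \<open>(1 - q) * L\<close> of \<open>a (m + 2) - q * a (m + 1)\<close>.\<close>
    define c where "c = (1 - q) * L / 2"
    have c: "c > 0" using q Lpos by (simp add: c_def)
    have "(\<lambda>m. a (Suc (Suc m)) - q * a (Suc m)) \<longlonglongrightarrow> L - q * L"
      by (intro tendsto_intros LIMSEQ_Suc L)
    moreover have "c < L - q * L"
      using q Lpos mult_pos_pos[of "1 - q" L] by (simp add: c_def field_simps)
    ultimately have "eventually (\<lambda>m. c < a (Suc (Suc m)) - q * a (Suc m)) sequentially"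
      by (rule order_tendstoD)
    then obtain m0 where m0: "\<And>m. m \<ge> m0 \<Longrightarrow> c < a (Suc (Suc m)) - q * a (Suc m)"
      by (auto simp: eventually_sequentially)
    have step: "c / real (Suc m) \<le> b m - b (Suc m)" if "m \<ge> m0" for m
    proof -
      have "real (Suc m) * (b m - b (Suc m)) = real n * b (Suc m) - q * a (Suc m)"
        using rec[of m] by (simp add: algebra_simps)
      also have "\<dots> \<ge> c" using m0[OF that] le[of "Suc m"] by simp
      finally show ?thesis by (simp add: field_simps)
    qed
    have "summable (\<lambda>m. c / real (Suc (m + m0)))"
    proof (rule summableI_nonneg_bounded[where x = "b m0"])
      show "0 \<le> c / real (Suc (m + m0))" for m using c by simp
      fix k
      have "(\<Sum>m<k. c / real (Suc (m + m0))) \<le> (\<Sum>m<k. b (m + m0) - b (Suc m + m0))"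
      proof (intro sum_mono)
        fix m
        show "c / real (Suc (m + m0)) \<le> b (m + m0) - b (Suc m + m0)"
          using step[of "m + m0"] by simp
      qed
      also have "\<dots> = b m0 - b (k + m0)"
        using sum_lessThan_telescope'[of "\<lambda>m. b (m + m0)" k] by simp
      finally show "(\<Sum>m<k. c / real (Suc (m + m0))) \<le> b m0" using b0[of "k + m0"] by simp
    qed
    then have "summable (\<lambda>m. c / real (Suc m))"
      using summable_iff_shift[of "\<lambda>m. c / real (Suc m)" m0] by simp
    then have "summable (\<lambda>m. (1 / c) * (c / real (Suc m)))" by (rule summable_mult)
    then have "summable (\<lambda>m. inverse (real (Suc m)))"
      using c by (simp add: inverse_eq_divide)
    then show False
      using not_summable_harmonic[where 'a = real] summable_Suc_iff[of "\<lambda>m. inverse (real m)"] by simp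
  qed
  with L show ?thesis by simp
qed

section \<open>Cliques in overlap arrays\<close>

text \<open>All entries of the array \<open>R\<close> between distinct indices of \<open>I\<close> lie in \<open>B\<close>; the diagonal is
  not constrained.\<close>

definition clique :: "real set \<Rightarrow> (nat \<Rightarrow> nat \<Rightarrow> real) \<Rightarrow> nat set \<Rightarrow> bool" where
  "clique B R I \<longleftrightarrow> (\<forall>l\<in>I. \<forall>l'\<in>I. l \<noteq> l' \<longrightarrow> R l l' \<in> B)"

text \<open>The first \<open>n\<close> indices form a clique that none of the next \<open>m\<close> indices extends. The entries
  are only inspected in the order (member, newcomer), which suffices for symmetric arrays.\<close>

definition stuck :: "real set \<Rightarrow> nat \<Rightarrow> nat \<Rightarrow> (nat \<Rightarrow> nat \<Rightarrow> real) \<Rightarrow> bool" where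
  "stuck B n m R \<longleftrightarrow>
     clique B R {1..n} \<and> (\<forall>j\<in>{n+1..n+m}. \<exists>l\<in>{1..n}. R l j \<notin> B)"

section \<open>Measurability on sequence space\<close>

text \<open>The \<open>\<sigma>\<close>-algebra of the replica sequences. Only its measurable sets matter, since the factor
  \<open>borel\<close> carries the zero measure.\<close>

abbreviation seq_algebra :: "(nat \<Rightarrow> 'a::topological_space) measure" where
  "seq_algebra \<equiv> (\<Pi>\<^sub>M l\<in>{1..}. borel)"

text \<open>This includes the index \<open>0\<close> outside the index set, where all sequences of the product space
  take the value \<open>undefined\<close>.\<close>

lemma measurable_coordinate:
  "(\<lambda>\<sigma>. \<sigma> i) \<in> (seq_algebra :: (nat \<Rightarrow> 'a::topological_space) measure) \<rightarrow>\<^sub>M borel"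
proof (cases "i \<in> {1..}")
  case True
  then show ?thesis by (rule measurable_component_singleton)
next
  case False
  then have "(\<lambda>\<sigma>. \<sigma> i) \<in> (seq_algebra :: (nat \<Rightarrow> 'a) measure) \<rightarrow>\<^sub>M borel
      \<longleftrightarrow> (\<lambda>_. undefined) \<in> (seq_algebra :: (nat \<Rightarrow> 'a) measure) \<rightarrow>\<^sub>M borel"
    by (subst measurable_cong[where g = "\<lambda>_. undefined"]) (auto simp: space_PiM PiE_def extensional_def)
  then show ?thesis by simp
qed

lemma measurable_overlap [measurable]:
  "(\<lambda>\<sigma> :: nat \<Rightarrow> 'a::{real_inner, second_countable_topology}. overlap \<sigma> i j)
     \<in> borel_measurable seq_algebra"
  unfolding overlap_def by (intro borel_measurable_inner measurable_coordinate)

lemma measurable_overlap_array [measurable]: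
  "overlap_array N \<in> (seq_algebra :: (nat \<Rightarrow> 'a::{real_inner, second_countable_topology}) measure)
     \<rightarrow>\<^sub>M (\<Pi>\<^sub>M p\<in>{1..N} \<times> {1..N}. borel)"
  unfolding overlap_array_def by (intro measurable_restrict) (auto simp del: One_nat_def)

lemma measurable_stuck_overlap [measurable]:
  assumes [measurable]: "B \<in> sets borel"
  shows "Measurable.pred seq_algebra
     (\<lambda>\<sigma> :: nat \<Rightarrow> 'a::{real_inner, second_countable_topology}. stuck B n m (overlap \<sigma>))"
  unfolding stuck_def clique_def by measurable

lemma sets_stuck_array:
  assumes [measurable]: "B \<in> sets borel"
  shows "{r\<in>space (\<Pi>\<^sub>M p\<in>{1..n+m} \<times> {1..n+m}. (borel :: real measure)). stuck B n m (curry r)}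
     \<in> sets (\<Pi>\<^sub>M p\<in>{1..n+m} \<times> {1..n+m}. (borel :: real measure))"
proof -
  have [measurable]: "(\<lambda>r. r (i, j)) \<in> borel_measurable (\<Pi>\<^sub>M p\<in>{1..n+m} \<times> {1..n+m}. (borel :: real measure))"
    if "i \<in> {1..n+m}" "j \<in> {1..n+m}" for i j
    using that by (intro measurable_component_singleton) auto
  have "Measurable.pred (\<Pi>\<^sub>M p\<in>{1..n+m} \<times> {1..n+m}. (borel :: real measure)) (\<lambda>r. stuck B n m (curry r))"
    unfolding stuck_def clique_def curry_def
    by (intro pred_intros_logic pred_intros_finite pred_sets2[where N = borel]) auto
  then show ?thesis by (simp add: pred_def)
qed

section \<open>Congruence and symmetry of the stuck event\<close>

lemma stuck_cong:
  assumes "\<And>i j. i \<in> {1..n+m} \<Longrightarrow> j \<in> {1..n+m} \<Longrightarrow> R i j = R' i j"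
  shows "stuck B n m R \<longleftrightarrow> stuck B n m R'"
  using assms unfolding stuck_def clique_def by auto

lemma stuck_miss_cong:
  assumes eq: "\<And>i j. 1 \<le> i \<Longrightarrow> 1 \<le> j \<Longrightarrow> R i j = R' i j" and k: "1 \<le> k"
  shows "(stuck B n m R \<and> R 1 k \<notin> B) \<longleftrightarrow> (stuck B n m R' \<and> R' 1 k \<notin> B)"
proof -
  have "stuck B n m R \<longleftrightarrow> stuck B n m R'" by (rule stuck_cong) (simp add: eq)
  with eq[OF le_refl k] show ?thesis by simp
qed

lemma stuck_Suc:
  "stuck B n (Suc m) R \<longleftrightarrow> stuck B n m R \<and> (\<exists>l\<in>{1..n}. R l (n + m + 1) \<notin> B)"
proof -
  have "{n+1..n+Suc m} = insert (n + m + 1) {n+1..n+m}" by auto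
  then show ?thesis unfolding stuck_def by auto
qed

lemma stuck_permute:
  assumes "inj \<pi>" "\<pi> ` {1..n} = {1..n}" "\<pi> ` {n+1..n+m} = {n+1..n+m}"
  shows "stuck B n m (\<lambda>i j. R (\<pi> i) (\<pi> j)) \<longleftrightarrow> stuck B n m R"
proof -
  have "stuck B n m R \<longleftrightarrow>
     (\<forall>l\<in>\<pi> ` {1..n}. \<forall>l'\<in>\<pi> ` {1..n}. l \<noteq> l' \<longrightarrow> R l l' \<in> B) \<and>
     (\<forall>j\<in>\<pi> ` {n+1..n+m}. \<exists>l\<in>\<pi> ` {1..n}. R l j \<notin> B)"
    unfolding assms stuck_def clique_def ..
  also have "\<dots> \<longleftrightarrow> stuck B n m (\<lambda>i j. R (\<pi> i) (\<pi> j))"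
    unfolding stuck_def clique_def by (simp add: inj_eq[OF \<open>inj \<pi>\<close>])
  finally show ?thesis ..
qed

section \<open>Exchangeable replicas satisfying the Ghirlanda-Guerra identities\<close>

text \<open>A law on replica sequences that is invariant under passing to the subsequence given by any
  injection of indices, and that satisfies the Ghirlanda-Guerra identities for indicator functions,
  written as identities between probabilities.\<close>

locale gg_replicas = prob_space P
  for P :: "(nat \<Rightarrow> 'a::{real_inner, second_countable_topology}) measure" +
  assumes sets_P [measurable_cong]: "sets P = sets seq_algebra"
    and exchangeable: "\<And>\<pi>. inj_on \<pi> {1..} \<Longrightarrow> \<pi> \<in> {1..} \<rightarrow> {1..} \<Longrightarrow>
           distr P seq_algebra (\<lambda>\<sigma>. \<lambda>n\<in>{1..}. \<sigma> (\<pi> n)) = P"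
    and gg: "\<And>N A C. N \<ge> 2 \<Longrightarrow> A \<in> sets (\<Pi>\<^sub>M p\<in>{1..N} \<times> {1..N}. (borel :: real measure)) \<Longrightarrow>
           C \<in> sets borel \<Longrightarrow>
           prob {\<sigma>\<in>space P. overlap_array N \<sigma> \<in> A \<and> overlap \<sigma> 1 (N + 1) \<in> C} =
             1 / real N * prob {\<sigma>\<in>space P. overlap_array N \<sigma> \<in> A}
                        * prob {\<sigma>\<in>space P. overlap \<sigma> 1 2 \<in> C}
             + 1 / real N * (\<Sum>l=2..N. prob {\<sigma>\<in>space P. overlap_array N \<sigma> \<in> A \<and> overlap \<sigma> 1 l \<in> C})"
begin

lemma measurable_reindex:
  assumes "\<pi> \<in> {1..} \<rightarrow> {1..}"
  shows "(\<lambda>\<sigma>. \<lambda>n\<in>{1..}. \<sigma> (\<pi> n)) \<in> P \<rightarrow>\<^sub>M seq_algebra"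
  using assms by (auto intro!: measurable_restrict measurable_component_singleton
      simp: measurable_cong_sets[OF sets_P refl])

lemma prob_reindex:
  assumes \<pi>: "inj_on \<pi> {1..}" "\<pi> \<in> {1..} \<rightarrow> {1..}"
    and [measurable]: "Measurable.pred seq_algebra Q"
  shows "prob {\<sigma>\<in>space P. Q (\<lambda>n\<in>{1..}. \<sigma> (\<pi> n))} = prob {\<sigma>\<in>space P. Q \<sigma>}"
proof -
  have sp: "space P = space seq_algebra" using sets_eq_imp_space_eq[OF sets_P] .
  note [measurable] = measurable_reindex[OF \<pi>(2)]
  have "prob {\<sigma>\<in>space P. Q \<sigma>} =
      measure (distr P seq_algebra (\<lambda>\<sigma>. \<lambda>n\<in>{1..}. \<sigma> (\<pi> n))) {\<sigma>\<in>space seq_algebra. Q \<sigma>}"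
    using exchangeable[OF \<pi>] by (simp add: sp)
  also have "\<dots> = prob ((\<lambda>\<sigma>. \<lambda>n\<in>{1..}. \<sigma> (\<pi> n)) -` {\<sigma>\<in>space seq_algebra. Q \<sigma>} \<inter> space P)"
    by (rule measure_distr) measurable
  also have "(\<lambda>\<sigma>. \<lambda>n\<in>{1..}. \<sigma> (\<pi> n)) -` {\<sigma>\<in>space seq_algebra. Q \<sigma>} \<inter> space P
      = {\<sigma>\<in>space P. Q (\<lambda>n\<in>{1..}. \<sigma> (\<pi> n))}"
    using \<pi>(2) by (auto simp: sp space_PiM PiE_def Pi_def)
  finally show ?thesis by simp
qed

text \<open>Exchangeability for events of the overlap array. The locality hypothesis says that the event
  does not depend on the entries with index \<open>0\<close>, where the reindexed sequence is \<open>undefined\<close>.\<close>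

lemma prob_transpose:
  fixes F :: "(nat \<Rightarrow> nat \<Rightarrow> real) \<Rightarrow> bool"
  assumes ab: "1 \<le> a" "1 \<le> b"
    and meas: "Measurable.pred seq_algebra (\<lambda>\<sigma> :: nat \<Rightarrow> 'a. F (overlap \<sigma>))"
    and local: "\<And>R R'. (\<And>i j. 1 \<le> i \<Longrightarrow> 1 \<le> j \<Longrightarrow> R i j = R' i j) \<Longrightarrow> F R = F R'"
  shows "prob {\<sigma>\<in>space P. F (\<lambda>i j. overlap \<sigma> (Transposition.transpose a b i) (Transposition.transpose a b j))}
       = prob {\<sigma>\<in>space P. F (overlap \<sigma>)}"
proof -
  let ?t = "Transposition.transpose a b"
  have inj: "inj_on ?t {1..}" by (rule inj_on_subset[OF inj_transpose]) simp
  have rng: "?t \<in> {1..} \<rightarrow> {1..}" using ab by (auto simp: Transposition.transpose_def)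
  have "F (overlap (\<lambda>n\<in>{1..}. \<sigma> (?t n))) = F (\<lambda>i j. overlap \<sigma> (?t i) (?t j))" for \<sigma> :: "nat \<Rightarrow> 'a"
    by (rule local) (auto simp: overlap_def)
  then show ?thesis using prob_reindex[OF inj rng meas] by simp
qed

context
  fixes B :: "real set" and n :: nat
  assumes B [measurable]: "B \<in> sets borel" and n: "1 \<le> n"
begin

text \<open>The sequence \<open>a\<close> of the introduction.\<close>

definition stuck_prob :: "nat \<Rightarrow> real" where
  "stuck_prob m = prob {\<sigma>\<in>space P. stuck B n m (overlap \<sigma>)}"

text \<open>The sequence \<open>b\<close> of the introduction: the next replica moreover fails to extend the clique
  because of its overlap with the first member.\<close>

definition stuck_miss_prob :: "nat \<Rightarrow> real" where
  "stuck_miss_prob m = prob {\<sigma>\<in>space P. stuck B n m (overlap \<sigma>) \<and> overlap \<sigma> 1 (n + m + 1) \<notin> B}"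

lemma measurable_stuck_miss:
  "Measurable.pred seq_algebra (\<lambda>\<sigma> :: nat \<Rightarrow> 'a. stuck B n m (overlap \<sigma>) \<and> overlap \<sigma> 1 k \<notin> B)"
  by measurable

text \<open>A further replica that does not extend the clique misses \<open>B\<close> with some member, and by
  exchangeability each member is as likely to be missed as the first.\<close>

lemma stuck_prob_le: "stuck_prob (Suc m) \<le> real n * stuck_miss_prob m"
proof -
  let ?E = "\<lambda>l. {\<sigma>\<in>space P. stuck B n m (overlap \<sigma>) \<and> overlap \<sigma> l (n + m + 1) \<notin> B}"
  have E: "prob (?E l) = stuck_miss_prob m" if l: "l \<in> {1..n}" for l
  proof -
    let ?t = "Transposition.transpose 1 l"
    have t: "stuck B n m (\<lambda>i j. R (?t i) (?t j)) \<longleftrightarrow> stuck B n m R" for R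
      using l by (intro stuck_permute inj_transpose)
        (auto simp: Transposition.transpose_def image_def split: if_splits)
    have t': "?t 1 = l" "?t (n + m + 1) = n + m + 1"
      using l by (auto simp: Transposition.transpose_def)
    have "prob {\<sigma>\<in>space P. stuck B n m (\<lambda>i j. overlap \<sigma> (?t i) (?t j)) \<and> overlap \<sigma> (?t 1) (?t (n + m + 1)) \<notin> B}
        = stuck_miss_prob m"
      unfolding stuck_miss_prob_def
      by (rule prob_transpose[where F = "\<lambda>R. stuck B n m R \<and> R 1 (n + m + 1) \<notin> B", OF _ _ measurable_stuck_miss stuck_miss_cong]) (use l in auto)
    then show ?thesis unfolding t t' .
  qed
  have "stuck_prob (Suc m) = prob (\<Union>l\<in>{1..n}. ?E l)"
    unfolding stuck_prob_def stuck_Suc by (intro arg_cong[where f = prob]) auto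
  also have "\<dots> \<le> (\<Sum>l\<in>{1..n}. prob (?E l))"
    by (intro finite_measure_subadditive_finite) auto
  also have "\<dots> = (\<Sum>l\<in>{1..n}. stuck_miss_prob m)" by (rule sum.cong[OF refl E])
  also have "\<dots> = real n * stuck_miss_prob m" by simp
  finally show ?thesis .
qed

text \<open>The Ghirlanda-Guerra identity with \<open>n + Suc m\<close> replicas. It is used from \<open>Suc m\<close> on because
  it requires at least two replicas, while \<open>n\<close> may be \<open>1\<close>.\<close>

lemma stuck_miss_prob_rec:
  "real (n + Suc m) * stuck_miss_prob (Suc m) =
     prob {\<sigma>\<in>space P. overlap \<sigma> 1 2 \<notin> B} * stuck_prob (Suc m) + real (Suc m) * stuck_miss_prob m"
proof -
  define N where "N = n + Suc m"
  define A where "A = {r\<in>space (\<Pi>\<^sub>M p\<in>{1..N} \<times> {1..N}. (borel :: real measure)). stuck B n (Suc m) (curry r)}"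
  have N: "N \<ge> 2" using n by (simp add: N_def)
  have A: "A \<in> sets (\<Pi>\<^sub>M p\<in>{1..N} \<times> {1..N}. (borel :: real measure))"
    unfolding A_def N_def by (rule sets_stuck_array) fact
  have inA: "overlap_array N \<sigma> \<in> A \<longleftrightarrow> stuck B n (Suc m) (overlap \<sigma>)" for \<sigma> :: "nat \<Rightarrow> 'a"
  proof -
    have "stuck B n (Suc m) (curry (overlap_array N \<sigma>)) \<longleftrightarrow> stuck B n (Suc m) (overlap \<sigma>)"
      by (rule stuck_cong) (auto simp: overlap_array_def N_def)
    then show ?thesis by (auto simp: A_def overlap_array_def space_PiM)
  qed
  let ?p = "\<lambda>l. prob {\<sigma>\<in>space P. stuck B n (Suc m) (overlap \<sigma>) \<and> overlap \<sigma> 1 l \<notin> B}"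
  have old: "?p l = 0" if "l \<in> {2..n}" for l
  proof -
    have "1 \<in> {1..n}" "l \<in> {1..n}" "1 \<noteq> l" using that n by auto
    then have "\<not> (stuck B n (Suc m) R \<and> R 1 l \<notin> B)" for R
      unfolding stuck_def clique_def by blast
    then show ?thesis by (simp only: simp_thms Collect_empty_eq) simp
  qed
  have new: "?p l = stuck_miss_prob m" if l: "l \<in> {n+1..N}" for l
  proof -
    let ?t = "Transposition.transpose l N"
    have t: "stuck B n (Suc m) (\<lambda>i j. R (?t i) (?t j)) \<longleftrightarrow> stuck B n (Suc m) R" for R
      using l by (intro stuck_permute inj_transpose)
        (auto simp: Transposition.transpose_def image_def N_def split: if_splits)
    have t': "?t 1 = 1" "?t N = l"
      using l n by (auto simp: Transposition.transpose_def N_def)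
    \<comment> \<open>An overlap with the first member outside \<open>B\<close> already prevents replica \<open>N\<close> from extending.\<close>
    have s: "stuck B n (Suc m) R \<and> R 1 N \<notin> B \<longleftrightarrow> stuck B n m R \<and> R 1 (n + m + 1) \<notin> B" for R
      using n by (auto simp: stuck_Suc N_def)
    have "prob {\<sigma>\<in>space P. stuck B n (Suc m) (\<lambda>i j. overlap \<sigma> (?t i) (?t j)) \<and> overlap \<sigma> (?t 1) (?t N) \<notin> B}
        = prob {\<sigma>\<in>space P. stuck B n (Suc m) (overlap \<sigma>) \<and> overlap \<sigma> 1 N \<notin> B}"
      by (rule prob_transpose[where F = "\<lambda>R. stuck B n (Suc m) R \<and> R 1 N \<notin> B", OF _ _ measurable_stuck_miss stuck_miss_cong]) (use l in \<open>auto simp: N_def\<close>)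
    then have "?p l = prob {\<sigma>\<in>space P. stuck B n (Suc m) (overlap \<sigma>) \<and> overlap \<sigma> 1 N \<notin> B}"
      unfolding t t' .
    then show ?thesis unfolding s stuck_miss_prob_def .
  qed
  have "{2..N} = {2..n} \<union> {n+1..N}" using n by (auto simp: N_def)
  then have "(\<Sum>l=2..N. ?p l) = (\<Sum>l\<in>{2..n}. ?p l) + (\<Sum>l\<in>{n+1..N}. ?p l)"
    by (simp add: sum.union_disjoint)
  also have "\<dots> = (\<Sum>l\<in>{2..n}. 0) + (\<Sum>l\<in>{n+1..N}. stuck_miss_prob m)"
    by (intro arg_cong2[where f = "(+)"] sum.cong refl old new)
  also have "\<dots> = real (Suc m) * stuck_miss_prob m" by (simp add: N_def)
  finally have sum: "(\<Sum>l=2..N. ?p l) = real (Suc m) * stuck_miss_prob m" .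
  have "stuck_miss_prob (Suc m) =
      1 / real N * stuck_prob (Suc m) * prob {\<sigma>\<in>space P. overlap \<sigma> 1 2 \<notin> B}
      + 1 / real N * (\<Sum>l=2..N. ?p l)"
    using gg[OF N A, of "- B"] B unfolding inA Compl_iff by (simp add: stuck_miss_prob_def stuck_prob_def N_def)
  also have "\<dots> = (prob {\<sigma>\<in>space P. overlap \<sigma> 1 2 \<notin> B} * stuck_prob (Suc m)
      + real (Suc m) * stuck_miss_prob m) / real N"
    unfolding sum by (simp add: add_divide_distrib)
  finally show ?thesis using N unfolding N_def[symmetric] by simp
qed

lemma AE_initial_clique_extends:
  assumes pos: "prob {\<sigma>\<in>space P. overlap \<sigma> 1 2 \<in> B} > 0"
  shows "AE \<sigma> in P. clique B (overlap \<sigma>) {1..n} \<longrightarrow> (\<exists>j>n. \<forall>l\<in>{1..n}. overlap \<sigma> l j \<in> B)"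
proof -
  let ?E = "{\<sigma>\<in>space P. \<forall>m. stuck B n m (overlap \<sigma>)}"
  have q: "prob {\<sigma>\<in>space P. overlap \<sigma> 1 2 \<notin> B} < 1"
    using pos prob_neg[of "\<lambda>\<sigma>. overlap \<sigma> 1 2 \<in> B"] by simp
  have "decseq stuck_prob"
    unfolding decseq_Suc_iff stuck_prob_def stuck_Suc by (auto intro!: finite_measure_mono)
  then have lim: "stuck_prob \<longlonglongrightarrow> 0"
    using n q stuck_miss_prob_rec stuck_prob_le
    by (intro decreasing_recursion_limit_zero[where b = stuck_miss_prob and n = n and
          q = "prob {\<sigma>\<in>space P. overlap \<sigma> 1 2 \<notin> B}"])
       (auto simp: stuck_prob_def stuck_miss_prob_def)
  have "prob ?E \<le> stuck_prob m" for m
    unfolding stuck_prob_def by (intro finite_measure_mono) auto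
  then have "prob ?E \<le> 0" by (intro LIMSEQ_le_const[OF lim]) auto
  then have "prob ?E = 0" by (simp add: measure_le_0_iff)
  then have "AE \<sigma> in P. \<not> (\<forall>m. stuck B n m (overlap \<sigma>))"
    by (subst (asm) prob_eq_0) auto
  then show ?thesis
  proof eventually_elim
    case (elim \<sigma>)
    then obtain m where m: "\<not> stuck B n m (overlap \<sigma>)" by blast
    show ?case
    proof
      assume "clique B (overlap \<sigma>) {1..n}"
      with m obtain j where "j \<in> {n+1..n+m}" "\<forall>l\<in>{1..n}. overlap \<sigma> l j \<in> B"
        unfolding stuck_def by blast
      then show "\<exists>j>n. \<forall>l\<in>{1..n}. overlap \<sigma> l j \<in> B" by (intro exI[of _ j]) auto
    qed
  qed
qed

end

lemma AE_clique_extends: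
  assumes B [measurable]: "B \<in> sets borel"
    and pos: "prob {\<sigma>\<in>space P. overlap \<sigma> 1 2 \<in> B} > 0"
    and C: "finite C" "C \<noteq> {}" "C \<subseteq> {1..}"
  shows "AE \<sigma> in P. clique B (overlap \<sigma>) C \<longrightarrow> (\<exists>j\<in>{1..} - C. \<forall>l\<in>C. overlap \<sigma> l j \<in> B)"
proof -
  define n where "n = card C"
  have n: "1 \<le> n" using C by (simp add: n_def Suc_le_eq card_gt_0_iff)
  obtain h where h: "bij_betw h {1..n} C"
    using ex_bij_betw_nat_finite_1[OF C(1)] unfolding n_def by blast
  \<comment> \<open>An injection taking the first \<open>n\<close> indices to \<open>C\<close> and all later ones beyond \<open>C\<close>.\<close>
  define \<pi> where "\<pi> i = (if i \<le> n then h i else Max C + i)" for i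
  have hC: "h i \<in> C" if "i \<in> {1..n}" for i using h that by (auto simp: bij_betw_def)
  have big: "\<pi> i \<notin> C" "1 \<le> \<pi> i" if "i > n" for i
    using that Max_ge[OF C(1), of "\<pi> i"] by (auto simp: \<pi>_def)
  have img: "\<pi> ` {1..n} = C" using h by (auto simp: bij_betw_def \<pi>_def)
  have "inj_on h {1..n}" using h by (simp add: bij_betw_def)
  then have inj: "inj_on \<pi> {1..}"
    using hC big unfolding inj_on_def \<pi>_def by (smt (verit) add_left_cancel atLeastAtMost_iff atLeast_iff not_le)
  have rng: "\<pi> \<in> {1..} \<rightarrow> {1..}"
    using hC C(3) by (auto simp: \<pi>_def) (use C(3) in fastforce)
  let ?Q = "\<lambda>\<sigma> :: nat \<Rightarrow> 'a. clique B (overlap \<sigma>) {1..n} \<longrightarrow> (\<exists>j>n. \<forall>l\<in>{1..n}. overlap \<sigma> l j \<in> B)"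
  have "AE \<sigma> in distr P seq_algebra (\<lambda>\<sigma>. \<lambda>k\<in>{1..}. \<sigma> (\<pi> k)). ?Q \<sigma>"
    using AE_initial_clique_extends[OF B n pos] unfolding exchangeable[OF inj rng] .
  then have "AE \<sigma> in P. ?Q (\<lambda>k\<in>{1..}. \<sigma> (\<pi> k))"
    by (rule AE_distrD[OF measurable_reindex[OF rng]])
  then show ?thesis
  proof eventually_elim
    case (elim \<sigma>)
    define \<tau> where "\<tau> = (\<lambda>k\<in>{1..}. \<sigma> (\<pi> k))"
    have ov: "overlap \<tau> i j = overlap \<sigma> (\<pi> i) (\<pi> j)" if "1 \<le> i" "1 \<le> j" for i j
      using that by (simp add: overlap_def \<tau>_def)
    show ?case
    proof
      assume "clique B (overlap \<sigma>) C"
      then have "clique B (overlap \<tau>) {1..n}"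
        using inj_onD[OF inj] unfolding clique_def img[symmetric] by (fastforce simp: ov)
      with elim obtain j where j: "j > n" and ext: "\<forall>l\<in>{1..n}. overlap \<tau> l j \<in> B"
        unfolding \<tau>_def by blast
      have "\<forall>l\<in>C. overlap \<sigma> l (\<pi> j) \<in> B"
        using ext j unfolding img[symmetric] by (auto simp: ov)
      then show "\<exists>j\<in>{1..} - C. \<forall>l\<in>C. overlap \<sigma> l j \<in> B" using big[OF j] by auto
    qed
  qed
qed

end

section \<open>Infinite cliques from the extension property\<close>

lemma infinite_clique_of_extension:
  fixes R :: "nat \<Rightarrow> nat \<Rightarrow> real"
  assumes sym: "\<And>i j. R i j = R j i"
    and ext: "\<And>C. finite C \<Longrightarrow> C \<noteq> {} \<Longrightarrow> C \<subseteq> {1..} \<Longrightarrow> clique B R C \<Longrightarrow>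
                 \<exists>j\<in>{1..} - C. \<forall>l\<in>C. R l j \<in> B"
  shows "\<exists>s :: nat \<Rightarrow> nat. (\<forall>k. 1 \<le> s k) \<and> (\<forall>k k'. k \<noteq> k' \<longrightarrow> R (s k) (s k') \<in> B)"
proof -
  let ?good = "\<lambda>C. finite C \<and> C \<noteq> {} \<and> C \<subseteq> {1..} \<and> clique B R C"
  have "\<exists>C :: nat \<Rightarrow> nat set. \<forall>k. ?good (C k) \<and> C k \<subset> C (Suc k)"
  proof (rule dependent_nat_choice)
    show "\<exists>C. ?good C" by (rule exI[of _ "{1}"]) (simp add: clique_def)
    fix C :: "nat set" and k :: nat
    assume C: "?good C"
    then obtain j where "j \<in> {1..} - C" "\<forall>l\<in>C. R l j \<in> B" using ext by blast
    then show "\<exists>C'. ?good C' \<and> C \<subset> C'"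
      using C sym by (intro exI[of _ "insert j C"]) (auto simp: clique_def)
  qed
  then obtain C :: "nat \<Rightarrow> nat set" where *: "\<forall>k. ?good (C k) \<and> C k \<subset> C (Suc k)"
    by (rule exE)
  have C: "finite (C k)" "C k \<subseteq> {1..}" "clique B R (C k)" and strict: "C k \<subset> C (Suc k)" for k
    using spec[OF *, of k] by simp_all
  have mono: "C i \<subseteq> C j" if "i \<le> j" for i j
    by (rule lift_Suc_mono_le[of C, OF psubset_imp_subset[OF strict] that])
  have card: "k \<le> card (C k)" for k
  proof (induction k)
    case (Suc k)
    then show ?case using psubset_card_mono[OF C(1) strict[of k]] by linarith
  qed simp
  have inf: "infinite (\<Union>k. C k)"
  proof
    assume fin: "finite (\<Union>k. C k)"
    have "card (C (Suc (card (\<Union>k. C k)))) \<le> card (\<Union>k. C k)"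
      by (intro card_mono fin) auto
    then show False using card[of "Suc (card (\<Union>k. C k))"] by simp
  qed
  have cl: "R l l' \<in> B" if ll: "l \<in> (\<Union>k. C k)" "l' \<in> (\<Union>k. C k)" "l \<noteq> l'" for l l'
  proof -
    obtain i j where "l \<in> C i" "l' \<in> C j" using ll by blast
    then have "l \<in> C (max i j)" "l' \<in> C (max i j)" using mono[of i "max i j"] mono[of j "max i j"] by auto
    then show ?thesis using C(3)[of "max i j"] ll(3) unfolding clique_def by blast
  qed
  obtain s :: "nat \<Rightarrow> nat" where s: "inj s" "range s \<subseteq> (\<Union>k. C k)"
    using infinite_countable_subset[OF inf] by blast
  have sC: "s k \<in> (\<Union>k. C k)" for k using s(2) by blast
  show ?thesis
  proof (intro exI[of _ s] conjI allI impI)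
    show "1 \<le> s k" for k using sC[of k] C(2) by (meson UN_E atLeast_iff subsetD)
    show "R (s k) (s k') \<in> B" if "k \<noteq> k'" for k k'
      using that s(1) by (intro cl sC) (simp add: inj_eq)
  qed
qed

section \<open>The support carries the measure\<close>

text \<open>Outside the support, a point lies in a null set from a countable basis.\<close>

lemma AE_in_measure_support:
  fixes N :: "'a::second_countable_topology measure"
  assumes sets: "sets N = sets borel"
  shows "AE x in N. x \<in> measure_support N"
proof -
  obtain \<B> :: "'a set set" where \<B>: "countable \<B>" "topological_basis \<B>"
    using ex_countable_basis by blast
  have "AE x in N. \<forall>U\<in>{U\<in>\<B>. emeasure N U = 0}. x \<notin> U"
  proof (subst AE_ball_countable)
    show "countable {U\<in>\<B>. emeasure N U = 0}" using \<B>(1) by auto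
    show "\<forall>U\<in>{U\<in>\<B>. emeasure N U = 0}. AE x in N. x \<notin> U"
      using topological_basis_open[OF \<B>(2)] sets by (auto intro!: AE_not_in simp: null_sets_def)
  qed
  then show ?thesis
  proof eventually_elim
    case (elim x)
    have "emeasure N U > 0" if U: "open U" "x \<in> U" for U
    proof -
      obtain V where V: "V \<in> \<B>" "x \<in> V" "V \<subseteq> U" using topological_basisE[OF \<B>(2) U] by blast
      then have "emeasure N V \<noteq> 0" using elim by auto
      moreover have "emeasure N V \<le> emeasure N U" using V(3) U(1) by (intro emeasure_mono) (auto simp: sets)
      ultimately show ?thesis by (auto simp: zero_less_iff_neq_zero)
    qed
    then show ?case by (simp add: measure_support_def)
  qed
qed

section \<open>The averaged law of the replicas\<close>

lemma measurable_replica_measure: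
  "replica_measure \<in> prob_algebra (borel :: 'a::topological_space measure) \<rightarrow>\<^sub>M prob_algebra seq_algebra"
proof (rule measurable_prob_algebra_generated)
  show "sets (seq_algebra :: (nat \<Rightarrow> 'a) measure)
      = sigma_sets (\<Pi>\<^sub>E l\<in>{1..}. space borel) (prod_algebra {1..} (\<lambda>_. borel))"
    by (rule sets_PiM)
  show "Int_stable (prod_algebra {1..} (\<lambda>_. borel :: 'a measure))" by (rule Int_stable_prod_algebra)
  show "prod_algebra {1..} (\<lambda>_. borel :: 'a measure) \<subseteq> Pow (\<Pi>\<^sub>E l\<in>{1..}. space borel)"
    by (rule prod_algebra_sets_into_space)
next
  fix N :: "'a measure" assume "N \<in> space (prob_algebra borel)"
  then have N: "prob_space N" "sets N = sets borel" by (auto simp: space_prob_algebra)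
  show "prob_space (replica_measure N)" unfolding replica_measure_def by (intro prob_space_PiM N)
  show "sets (replica_measure N) = sets seq_algebra"
    unfolding replica_measure_def by (intro sets_PiM_cong refl N)
next
  fix A :: "(nat \<Rightarrow> 'a) set"
  assume "A \<in> prod_algebra {1..} (\<lambda>_. borel :: 'a measure)"
  from prod_algebraE[OF this] obtain J E where A: "A = prod_emb {1..} (\<lambda>_. borel :: 'a measure) J (Pi\<^sub>E J E)"
    and J: "finite J" "J \<subseteq> {1..}" and E: "\<And>i. i \<in> J \<Longrightarrow> E i \<in> sets borel" by metis
  have "emeasure (replica_measure N) A = (\<Prod>i\<in>J. emeasure N (E i))"
    if "N \<in> space (prob_algebra borel)" for N :: "'a measure"
  proof -
    from that have N: "prob_space N" "sets N = sets borel" by (auto simp: space_prob_algebra)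
    have "A = prod_emb {1..} (\<lambda>_. N) J (Pi\<^sub>E J E)"
      using sets_eq_imp_space_eq[OF N(2)] by (simp add: A prod_emb_def)
    then show ?thesis
      unfolding replica_measure_def using J E N by (simp add: emeasure_PiM_emb)
  qed
  moreover have "(\<lambda>N. \<Prod>i\<in>J. emeasure N (E i)) \<in> borel_measurable (prob_algebra (borel :: 'a measure))"
    using E by (intro borel_measurable_prod_ennreal measurable_compose[OF measurable_prob_algebraD[OF measurable_ident, unfolded id_def]
        measurable_emeasure_subprob_algebra])
  ultimately show "(\<lambda>N. emeasure (replica_measure N) A) \<in> borel_measurable (prob_algebra borel)"
    by (simp cong: measurable_cong)
qed

text \<open>The law of the replicas under the joint randomness of the measure and of the sample, that is,
  the law behind \<open>replica_expectation\<close>.\<close>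

definition annealed_replicas ::
  "'w measure \<Rightarrow> ('w \<Rightarrow> 'a::topological_space measure) \<Rightarrow> (nat \<Rightarrow> 'a) measure" where
  "annealed_replicas M G = M \<bind> (\<lambda>\<omega>. replica_measure (G \<omega>))"

context
  fixes M :: "'w measure"
    and G :: "'w \<Rightarrow> 'a::{real_inner, banach, second_countable_topology} measure"
  assumes ball: "random_measure_on_ball M G"
begin

lemma prob_space_base: "prob_space M" and measurable_G: "G \<in> M \<rightarrow>\<^sub>M prob_algebra borel"
  using ball by (auto simp: random_measure_on_ball_def)

lemma prob_space_G: "\<omega> \<in> space M \<Longrightarrow> prob_space (G \<omega>)"
  and sets_G: "\<omega> \<in> space M \<Longrightarrow> sets (G \<omega>) = sets borel"
  using measurable_space[OF measurable_G] by (auto simp: space_prob_algebra)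

lemma measurable_replica_kernel:
  "(\<lambda>\<omega>. replica_measure (G \<omega>)) \<in> M \<rightarrow>\<^sub>M prob_algebra seq_algebra"
  by (rule measurable_compose[OF measurable_G measurable_replica_measure])

lemmas measurable_replica_kernel_subprob = measurable_prob_algebraD[OF measurable_replica_kernel]

lemma base_in_prob_algebra: "M \<in> space (prob_algebra M)"
  using prob_space_base by (simp add: space_prob_algebra)

lemma prob_space_annealed: "prob_space (annealed_replicas M G)"
  unfolding annealed_replicas_def by (rule prob_space_bind'[OF base_in_prob_algebra measurable_replica_kernel])

lemma sets_annealed: "sets (annealed_replicas M G) = sets seq_algebra"
  unfolding annealed_replicas_def by (rule sets_bind'[OF base_in_prob_algebra measurable_replica_kernel])

lemma replica_expectation_indicator:
  assumes X: "{\<sigma>\<in>space seq_algebra. Q \<sigma>} \<in> sets seq_algebra"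
    and F: "\<And>\<sigma>. F \<sigma> = of_bool (Q \<sigma>)"
  shows "replica_expectation M G F = measure (annealed_replicas M G) {\<sigma>\<in>space (annealed_replicas M G). Q \<sigma>}"
proof -
  interpret M: prob_space M by (rule prob_space_base)
  let ?X = "{\<sigma>\<in>space seq_algebra. Q \<sigma>}"
  have "measure (annealed_replicas M G) ?X = (\<integral>\<omega>. measure (replica_measure (G \<omega>)) ?X \<partial>M)"
    unfolding annealed_replicas_def by (rule M.measure_bind[OF measurable_replica_kernel_subprob X])
  also have "\<dots> = (\<integral>\<omega>. (\<integral>\<sigma>. F \<sigma> \<partial>replica_measure (G \<omega>)) \<partial>M)"
  proof (rule Bochner_Integration.integral_cong[OF refl])
    fix \<omega> assume "\<omega> \<in> space M"
    then have sets: "sets (replica_measure (G \<omega>)) = sets seq_algebra"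
      using measurable_space[OF measurable_replica_kernel] by (auto simp: space_prob_algebra)
    have "(\<integral>\<sigma>. F \<sigma> \<partial>replica_measure (G \<omega>)) = (\<integral>\<sigma>. indicator ?X \<sigma> \<partial>replica_measure (G \<omega>))"
      using sets_eq_imp_space_eq[OF sets]
      by (intro Bochner_Integration.integral_cong) (auto simp: F indicator_def)
    also have "\<dots> = measure (replica_measure (G \<omega>)) ?X"
      using sets.sets_into_space[OF X] sets_eq_imp_space_eq[OF sets] by (simp add: Int_absorb2)
    finally show "measure (replica_measure (G \<omega>)) ?X = (\<integral>\<sigma>. F \<sigma> \<partial>replica_measure (G \<omega>))" ..
  qed
  finally show ?thesis
    by (simp add: replica_expectation_def sets_eq_imp_space_eq[OF sets_annealed])
qed

lemma annealed_exchangeable: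
  assumes \<pi>: "inj_on \<pi> {1..}" "\<pi> \<in> {1..} \<rightarrow> {1..}"
  shows "distr (annealed_replicas M G) seq_algebra (\<lambda>\<sigma>. \<lambda>n\<in>{1..}. \<sigma> (\<pi> n)) = annealed_replicas M G"
proof -
  interpret M: prob_space M by (rule prob_space_base)
  let ?f = "\<lambda>\<sigma> :: nat \<Rightarrow> 'a. \<lambda>n\<in>{1..}. \<sigma> (\<pi> n)"
  have f: "?f \<in> seq_algebra \<rightarrow>\<^sub>M seq_algebra"
    using \<pi>(2) by (auto intro!: measurable_restrict measurable_component_singleton)
  have "distr (annealed_replicas M G) seq_algebra ?f
      = M \<bind> (\<lambda>\<omega>. distr (replica_measure (G \<omega>)) seq_algebra ?f)"
    unfolding annealed_replicas_def
    by (rule distr_bind[OF measurable_replica_kernel_subprob M.not_empty f])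
  also have "\<dots> = annealed_replicas M G"
    unfolding annealed_replicas_def
  proof (rule bind_cong[OF refl])
    fix \<omega> assume \<omega>: "\<omega> \<in> space M"
    have "distr (replica_measure (G \<omega>)) seq_algebra ?f
        = distr (replica_measure (G \<omega>)) (\<Pi>\<^sub>M n\<in>{1..}. G \<omega>) ?f"
      by (intro distr_cong refl sets_PiM_cong) (simp add: sets_G[OF \<omega>])
    also have "\<dots> = replica_measure (G \<omega>)"
      unfolding replica_measure_def using \<pi> by (intro distr_PiM_reindex prob_space_G[OF \<omega>])
    finally show "distr (replica_measure (G \<omega>)) seq_algebra ?f = replica_measure (G \<omega>)" .
  qed
  finally show ?thesis .
qed

lemma gg_replicas_annealed:
  assumes gg: "ghirlanda_guerra M G"
  shows "gg_replicas (annealed_replicas M G)"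
proof -
  interpret prob_space "annealed_replicas M G" by (rule prob_space_annealed)
  let ?P = "annealed_replicas M G"
  show ?thesis
  proof
    show "sets ?P = sets seq_algebra" by (rule sets_annealed)
  next
    fix \<pi> :: "nat \<Rightarrow> nat"
    assume "inj_on \<pi> {1..}" "\<pi> \<in> {1..} \<rightarrow> {1..}"
    then show "distr ?P seq_algebra (\<lambda>\<sigma>. \<lambda>n\<in>{1..}. \<sigma> (\<pi> n)) = ?P" by (rule annealed_exchangeable)
  next
    fix N :: nat and A C
    assume N: "2 \<le> N" and A [measurable]: "A \<in> sets (\<Pi>\<^sub>M p\<in>{1..N} \<times> {1..N}. (borel :: real measure))"
      and C [measurable]: "C \<in> sets (borel :: real measure)"
    let ?f = "indicator A :: (nat \<times> nat \<Rightarrow> real) \<Rightarrow> real" and ?\<psi> = "indicator C :: real \<Rightarrow> real"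
    have bdd: "bounded (indicator Y ` Z :: real set)" for Y Z :: "'b set"
      by (rule boundedI[where B = 1]) (auto simp: indicator_def)
    have pair: "replica_expectation M G (\<lambda>\<sigma>. ?f (overlap_array N \<sigma>) * ?\<psi> (overlap \<sigma> 1 l))
        = prob {\<sigma>\<in>space ?P. overlap_array N \<sigma> \<in> A \<and> overlap \<sigma> 1 l \<in> C}" for l
      by (rule replica_expectation_indicator) (auto simp: indicator_def simp del: One_nat_def)
    have "replica_expectation M G (\<lambda>\<sigma>. ?f (overlap_array N \<sigma>) * ?\<psi> (overlap \<sigma> 1 (N + 1))) =
          1 / real N * replica_expectation M G (\<lambda>\<sigma>. ?f (overlap_array N \<sigma>))
                     * replica_expectation M G (\<lambda>\<sigma>. ?\<psi> (overlap \<sigma> 1 2))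
          + 1 / real N * (\<Sum>l=2..N.
              replica_expectation M G (\<lambda>\<sigma>. ?f (overlap_array N \<sigma>) * ?\<psi> (overlap \<sigma> 1 l)))"
      using gg[unfolded ghirlanda_guerra_def, rule_format, of N ?f ?\<psi>, OF N _ bdd _ bdd] by measurable
    moreover have "replica_expectation M G (\<lambda>\<sigma>. ?f (overlap_array N \<sigma>))
        = prob {\<sigma>\<in>space ?P. overlap_array N \<sigma> \<in> A}"
      by (rule replica_expectation_indicator) (auto simp: indicator_def simp del: One_nat_def)
    moreover have "replica_expectation M G (\<lambda>\<sigma>. ?\<psi> (overlap \<sigma> 1 2))
        = prob {\<sigma>\<in>space ?P. overlap \<sigma> 1 2 \<in> C}"
      by (rule replica_expectation_indicator) (auto simp: indicator_def simp del: One_nat_def)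
    ultimately show "prob {\<sigma>\<in>space ?P. overlap_array N \<sigma> \<in> A \<and> overlap \<sigma> 1 (N + 1) \<in> C} =
             1 / real N * prob {\<sigma>\<in>space ?P. overlap_array N \<sigma> \<in> A}
                        * prob {\<sigma>\<in>space ?P. overlap \<sigma> 1 2 \<in> C}
             + 1 / real N * (\<Sum>l=2..N. prob {\<sigma>\<in>space ?P. overlap_array N \<sigma> \<in> A \<and> overlap \<sigma> 1 l \<in> C})"
      unfolding pair by simp
  qed
qed

lemma two_replicas_distr:
  assumes \<omega>: "\<omega> \<in> space M"
  shows "distr (replica_measure (G \<omega>)) (G \<omega> \<Otimes>\<^sub>M G \<omega>) (\<lambda>\<sigma>. (\<sigma> 1, \<sigma> 2)) = G \<omega> \<Otimes>\<^sub>M G \<omega>"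
proof -
  interpret N: prob_space "G \<omega>" by (rule prob_space_G[OF \<omega>])
  have [measurable]: "(\<lambda>\<sigma>. \<sigma> k) \<in> replica_measure (G \<omega>) \<rightarrow>\<^sub>M G \<omega>" if "k \<in> {1..}" for k
    unfolding replica_measure_def using that by (rule measurable_component_singleton)
  have m: "(\<lambda>\<sigma>. (\<sigma> 1, \<sigma> 2)) \<in> replica_measure (G \<omega>) \<rightarrow>\<^sub>M G \<omega> \<Otimes>\<^sub>M G \<omega>" by (intro measurable_Pair) auto
  show ?thesis
  proof (rule pair_measure_eqI[symmetric])
    fix X Y assume X: "X \<in> sets (G \<omega>)" and Y: "Y \<in> sets (G \<omega>)"
    define E where "E = (\<lambda>i::nat. if i = 1 then X else Y)"
    have "(\<lambda>\<sigma>. (\<sigma> 1, \<sigma> 2)) -` (X \<times> Y) \<inter> space (replica_measure (G \<omega>))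
        = prod_emb {1..} (\<lambda>_. G \<omega>) {1, 2} (Pi\<^sub>E {1, 2} E)"
      by (auto simp: prod_emb_def replica_measure_def space_PiM E_def PiE_def extensional_def Pi_def)
    then have "emeasure (distr (replica_measure (G \<omega>)) (G \<omega> \<Otimes>\<^sub>M G \<omega>) (\<lambda>\<sigma>. (\<sigma> 1, \<sigma> 2))) (X \<times> Y)
        = emeasure (replica_measure (G \<omega>)) (prod_emb {1..} (\<lambda>_. G \<omega>) {1, 2} (Pi\<^sub>E {1, 2} E))"
      using X Y by (subst emeasure_distr[OF m]) auto
    also have "\<dots> = (\<Prod>i\<in>{1, 2}. emeasure (G \<omega>) (E i))"
      unfolding replica_measure_def
      by (rule emeasure_PiM_emb) (use X Y in \<open>auto simp: E_def N.prob_space_axioms\<close>)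
    finally show "emeasure (G \<omega>) X * emeasure (G \<omega>) Y =
        emeasure (distr (replica_measure (G \<omega>)) (G \<omega> \<Otimes>\<^sub>M G \<omega>) (\<lambda>\<sigma>. (\<sigma> 1, \<sigma> 2))) (X \<times> Y)"
      by (simp add: E_def)
  qed (auto intro: N.sigma_finite_measure_axioms)
qed

lemma emeasure_overlap_law:
  assumes B [measurable]: "B \<in> sets borel"
  shows "emeasure (overlap_law M G) B
    = emeasure (annealed_replicas M G) {\<sigma>\<in>space (annealed_replicas M G). overlap \<sigma> 1 2 \<in> B}"
proof -
  interpret M: prob_space M by (rule prob_space_base)
  let ?ip = "\<lambda>(x, y). x \<bullet> y :: real"
  have kernel: "(\<lambda>\<omega>. G \<omega> \<Otimes>\<^sub>M G \<omega>) \<in> M \<rightarrow>\<^sub>M subprob_algebra (borel \<Otimes>\<^sub>M borel)"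
    by (intro measurable_prob_algebraD measurable_pair_prob measurable_G)
  have ip: "?ip \<in> (borel \<Otimes>\<^sub>M borel :: ('a \<times> 'a) measure) \<rightarrow>\<^sub>M borel" by measurable
  have X: "{\<sigma>\<in>space seq_algebra. overlap \<sigma> 1 2 \<in> B} \<in> sets (seq_algebra :: (nat \<Rightarrow> 'a) measure)"
    by measurable
  have "emeasure (overlap_law M G) B = (\<integral>\<^sup>+\<omega>. emeasure (distr (G \<omega> \<Otimes>\<^sub>M G \<omega>) borel ?ip) B \<partial>M)"
    unfolding overlap_law_def distr_bind[OF kernel M.not_empty ip]
    by (rule emeasure_bind[OF M.not_empty measurable_compose[OF kernel measurable_distr[OF ip]] B])
  also have "\<dots> = (\<integral>\<^sup>+\<omega>. emeasure (replica_measure (G \<omega>)) {\<sigma>\<in>space seq_algebra. overlap \<sigma> 1 2 \<in> B} \<partial>M)"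
  proof (rule nn_integral_cong)
    fix \<omega> assume \<omega>: "\<omega> \<in> space M"
    have sets: "sets (replica_measure (G \<omega>)) = sets seq_algebra"
      using measurable_space[OF measurable_replica_kernel \<omega>] by (auto simp: space_prob_algebra)
    have sets2: "sets (G \<omega> \<Otimes>\<^sub>M G \<omega>) = sets (borel \<Otimes>\<^sub>M borel)"
      by (intro sets_pair_measure_cong sets_G[OF \<omega>])
    have m: "(\<lambda>\<sigma>. (\<sigma> 1, \<sigma> 2)) \<in> replica_measure (G \<omega>) \<rightarrow>\<^sub>M G \<omega> \<Otimes>\<^sub>M G \<omega>"
      unfolding measurable_cong_sets[OF sets sets2] by (intro measurable_Pair measurable_coordinate)
    have ip': "?ip \<in> (G \<omega> \<Otimes>\<^sub>M G \<omega>) \<rightarrow>\<^sub>M borel"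
      using ip by (simp add: measurable_cong_sets[OF sets2 refl])
    have "distr (G \<omega> \<Otimes>\<^sub>M G \<omega>) borel ?ip = distr (replica_measure (G \<omega>)) borel (?ip \<circ> (\<lambda>\<sigma>. (\<sigma> 1, \<sigma> 2)))"
      using distr_distr[OF ip' m] unfolding two_replicas_distr[OF \<omega>] .
    also have "?ip \<circ> (\<lambda>\<sigma>. (\<sigma> 1, \<sigma> 2)) = (\<lambda>\<sigma>. overlap \<sigma> 1 2)" by (auto simp: overlap_def)
    finally have "emeasure (distr (G \<omega> \<Otimes>\<^sub>M G \<omega>) borel ?ip) B
        = emeasure (distr (replica_measure (G \<omega>)) borel (\<lambda>\<sigma>. overlap \<sigma> 1 2)) B" by simp
    also have "\<dots> = emeasure (replica_measure (G \<omega>)) ((\<lambda>\<sigma>. overlap \<sigma> 1 2) -` B \<inter> space (replica_measure (G \<omega>)))"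
      by (rule emeasure_distr[OF _ B]) (unfold measurable_cong_sets[OF sets refl], rule measurable_overlap)
    also have "(\<lambda>\<sigma>. overlap \<sigma> 1 2) -` B \<inter> space (replica_measure (G \<omega>))
        = {\<sigma>\<in>space seq_algebra. overlap \<sigma> 1 2 \<in> B}"
      using sets_eq_imp_space_eq[OF sets] by auto
    finally show "emeasure (distr (G \<omega> \<Otimes>\<^sub>M G \<omega>) borel ?ip) B
        = emeasure (replica_measure (G \<omega>)) {\<sigma>\<in>space seq_algebra. overlap \<sigma> 1 2 \<in> B}" .
  qed
  also have "\<dots> = emeasure (annealed_replicas M G) {\<sigma>\<in>space seq_algebra. overlap \<sigma> 1 2 \<in> B}"
    unfolding annealed_replicas_def
    by (rule emeasure_bind[OF M.not_empty measurable_replica_kernel_subprob X, symmetric])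
  finally show ?thesis by (simp add: sets_eq_imp_space_eq[OF sets_annealed])
qed

lemma AE_replicas_in_support:
  assumes \<omega>: "\<omega> \<in> space M"
  shows "AE \<sigma> in replica_measure (G \<omega>). \<forall>l\<in>{1..}. \<sigma> l \<in> measure_support (G \<omega>)"
  unfolding replica_measure_def
  by (subst AE_ball_countable)
     (auto intro!: AE_PiM_component prob_space_G[OF \<omega>] AE_in_measure_support sets_G[OF \<omega>])

end

section \<open>Infinite sequences in the support with overlaps in a given set\<close>

theorem mainTheorem7:
  fixes M :: "'w measure"
    and G :: "'w \<Rightarrow> 'a::{real_inner, banach, second_countable_topology} measure"
    and B :: "real set"
  assumes "random_measure_on_ball M G"
    and "ghirlanda_guerra M G"
    and "B \<in> sets borel"
    and "emeasure (overlap_law M G) B > 0"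
  shows "AE \<omega> in M. \<exists>\<sigma> :: nat \<Rightarrow> 'a.
           (\<forall>l\<ge>1. \<sigma> l \<in> measure_support (G \<omega>)) \<and>
           (\<forall>l\<ge>1. \<forall>l'\<ge>1. l \<noteq> l' \<longrightarrow> \<sigma> l \<bullet> \<sigma> l' \<in> B)"
proof -
  note ball = assms(1) and B [measurable] = assms(3)
  interpret P: gg_replicas "annealed_replicas M G"
    by (rule gg_replicas_annealed[OF ball assms(2)])
  let ?ext = "\<lambda>C (\<sigma> :: nat \<Rightarrow> 'a). clique B (overlap \<sigma>) C \<longrightarrow> (\<exists>j\<in>{1..} - C. \<forall>l\<in>C. overlap \<sigma> l j \<in> B)"
  let ?\<C> = "{C :: nat set. finite C \<and> C \<noteq> {} \<and> C \<subseteq> {1..}}"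
  have pos: "P.prob {\<sigma>\<in>space (annealed_replicas M G). overlap \<sigma> 1 2 \<in> B} > 0"
    using assms(4) unfolding emeasure_overlap_law[OF ball B] P.emeasure_eq_measure by simp
  have "countable ?\<C>"
    by (rule countable_subset[OF _ countable_Collect_finite]) auto
  moreover have "AE \<omega> in M. AE \<sigma> in replica_measure (G \<omega>). ?ext C \<sigma>" if "C \<in> ?\<C>" for C
  proof -
    have C: "finite C" "C \<noteq> {}" "C \<subseteq> {1..}" using that by auto
    have "Measurable.pred seq_algebra (?ext C)"
      unfolding clique_def using C(1) by measurable
    then show ?thesis
      using P.AE_clique_extends[OF B pos C]
        AE_bind[OF measurable_replica_kernel_subprob[OF ball]] unfolding annealed_replicas_def by blast
  qed
  ultimately have "AE \<omega> in M. \<forall>C\<in>?\<C>. AE \<sigma> in replica_measure (G \<omega>). ?ext C \<sigma>"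
    by (simp only: AE_ball_countable) blast
  then show ?thesis
  proof (rule AE_mp, intro AE_I2 impI)
    fix \<omega> assume \<omega>: "\<omega> \<in> space M"
      and ext: "\<forall>C\<in>?\<C>. AE \<sigma> in replica_measure (G \<omega>). ?ext C \<sigma>"
    interpret R: prob_space "replica_measure (G \<omega>)"
      unfolding replica_measure_def by (intro prob_space_PiM prob_space_G[OF ball \<omega>])
    have "AE \<sigma> in replica_measure (G \<omega>). \<forall>C\<in>?\<C>. ?ext C \<sigma>"
      using ext \<open>countable ?\<C>\<close> by (simp only: AE_ball_countable)
    with AE_replicas_in_support[OF ball \<omega>]
    have "AE \<sigma> in replica_measure (G \<omega>).
        (\<forall>l\<in>{1..}. \<sigma> l \<in> measure_support (G \<omega>)) \<and> (\<forall>C\<in>?\<C>. ?ext C \<sigma>)"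
      by (rule AE_conjI)
    then obtain \<sigma> where supp: "\<forall>l\<in>{1..}. \<sigma> l \<in> measure_support (G \<omega>)"
      and ext_\<sigma>: "\<forall>C\<in>?\<C>. ?ext C \<sigma>"
      using eventually_happens'[OF R.ae_filter_bot] by blast
    have sym: "overlap \<sigma> i j = overlap \<sigma> j i" for i j by (simp add: overlap_def inner_commute)
    have ext': "\<exists>j\<in>{1..} - C. \<forall>l\<in>C. overlap \<sigma> l j \<in> B"
      if "finite C" "C \<noteq> {}" "C \<subseteq> {1..}" "clique B (overlap \<sigma>) C" for C
      using bspec[OF ext_\<sigma>, of C] that by simp
    have "\<exists>s :: nat \<Rightarrow> nat. (\<forall>k. 1 \<le> s k) \<and> (\<forall>k k'. k \<noteq> k' \<longrightarrow> overlap \<sigma> (s k) (s k') \<in> B)"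
      by (intro infinite_clique_of_extension sym ext')
    then obtain s :: "nat \<Rightarrow> nat" where s: "\<And>k. 1 \<le> s k"
        "\<And>k k'. k \<noteq> k' \<Longrightarrow> overlap \<sigma> (s k) (s k') \<in> B" by blast
    show "\<exists>\<sigma> :: nat \<Rightarrow> 'a. (\<forall>l\<ge>1. \<sigma> l \<in> measure_support (G \<omega>)) \<and>
           (\<forall>l\<ge>1. \<forall>l'\<ge>1. l \<noteq> l' \<longrightarrow> \<sigma> l \<bullet> \<sigma> l' \<in> B)"
      using supp s by (intro exI[of _ "\<lambda>l. \<sigma> (s l)"]) (auto simp: overlap_def)
  qed
qed

end
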